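(* Let $G=(V,E)$ be any graph. (A) The following four statements are equivalent. (1) $\Theta_G=\Theta_G^*$ and $\Theta_G^*$ is $1$-trivial. (2) $\overline{\Theta}_G=\overline{\Theta}_G^*$ and $\overline{\Theta}_G^*$ is $|E|$-trivial. (3) $G$ is a $K_2$ or a $K_3$. (4) For all distinct edges $e,f$ of $G$ it holds that $|\Delta_{ef}|=2$. (B) The following four statements are equivalent. (1) $\Theta_G=\Theta_G^*$ and $\Theta_G^*$ is $|E|$-trivial. (2) $\overline{\Theta}_G=\overline{\Theta}_G^*$ and $\overline{\Theta}_G^*$ is $1$-trivial. (3) $G$ is a tree. (4) For all distinct edges $e,f$ of $G$ it holds that $|\Delta_{ef}|\neq 2$, or equivalently, for all distinct edges $e,f$ of $G$ it holds that $|\Delta_{ef}|=3$.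
   Context: Graphs are simple and undirected, with non-empty vertex set; $d$ is the shortest-path distance in $G$, with $d(u,v)=\infty$ if there is no path between $u$ and $v$ (and $\infty+\infty=\infty$). For edges $e=\{a,b\}$ and $f=\{x,y\}$ of $G$, $\Delta_{ef}$ is the set $\{d(a,x),d(b,y),d(a,y),d(b,x)\}$, and the relation $\Theta_G$ on $E(G)$ is defined by $(e,f)\in\Theta_G$ iff $d(a,x)+d(b,y)\neq d(a,y)+d(b,x)$. The relation $\overline{\Theta}_G$ on $E(G)$ is defined by $(e,f)\in\overline{\Theta}_G$ iff $e=f$, or $e\neq f$ and $(e,f)\notin\Theta_G$. For a reflexive and symmetric relation $R$ on $E$, $R^*$ denotes its transitive closure, which is an equivalence relation; $R^*$ is $1$-trivial if it consists of one equivalence class only, and $|E|$-trivial if it consists of precisely $|E|$ equivalence classes. $K_n$ is the complete graph on $n$ vertices; a tree is a connected graph without cycles.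
   Formalization: False for "any graph" (K_1; K_2 plus an isolated vertex; 2K_2): G must have an edge; (A3) is linked only if G has no isolated vertex, (B3) and |Δ|=3 only if G is connected; for infinite E, |E|-trivial means all classes are singletons (4-cycle plus ray). *)

theory Defs
  imports Complex_Main "HOL-Library.Extended_Nat"
begin

text \<open>
  A graph is given by its vertex set and its set of edges, an edge being a two-element
  set of vertices. Graphs may be infinite and need not be connected.
\<close>

definition graph :: "'a set \<Rightarrow> 'a set set \<Rightarrow> bool" where
  "graph V E \<longleftrightarrow> V \<noteq> {} \<and> E \<subseteq> {{u, v} | u v. u \<in> V \<and> v \<in> V \<and> u \<noteq> v}"

definition path :: "'a set \<Rightarrow> 'a set set \<Rightarrow> 'a \<Rightarrow> 'a list \<Rightarrow> 'a \<Rightarrow> bool" where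
  "path V E u p v \<longleftrightarrow>
     p \<noteq> [] \<and> hd p = u \<and> last p = v \<and> set p \<subseteq> V \<and> distinct p \<and>
     successively (\<lambda>x y. {x, y} \<in> E) p"

text \<open>
  A path on \<open>n\<close> vertices has length \<open>n - 1\<close>. The infimum of the empty set in \<^typ>\<open>enat\<close>
  is \<open>\<infinity>\<close>, so vertices not joined by a path have distance \<open>\<infinity>\<close>; also \<open>\<infinity> + \<infinity> = \<infinity>\<close>.
\<close>

definition gdist :: "'a set \<Rightarrow> 'a set set \<Rightarrow> 'a \<Rightarrow> 'a \<Rightarrow> enat" where
  "gdist V E u v = (INF p \<in> {p. path V E u p v}. enat (length p - 1))"

definition connected_graph :: "'a set \<Rightarrow> 'a set set \<Rightarrow> bool" where
  "connected_graph V E \<longleftrightarrow> (\<forall>u\<in>V. \<forall>v\<in>V. \<exists>p. path V E u p v)"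

definition cycle :: "'a set \<Rightarrow> 'a set set \<Rightarrow> 'a list \<Rightarrow> bool" where
  "cycle V E p \<longleftrightarrow> 3 \<le> length p \<and> path V E (hd p) p (last p) \<and> {last p, hd p} \<in> E"

definition tree :: "'a set \<Rightarrow> 'a set set \<Rightarrow> bool" where
  "tree V E \<longleftrightarrow> connected_graph V E \<and> (\<nexists>p. cycle V E p)"

definition complete_graph :: "nat \<Rightarrow> 'a set \<Rightarrow> 'a set set \<Rightarrow> bool" where
  "complete_graph n V E \<longleftrightarrow>
     finite V \<and> card V = n \<and> E = {{u, v} | u v. u \<in> V \<and> v \<in> V \<and> u \<noteq> v}"

definition no_isolated_vertex :: "'a set \<Rightarrow> 'a set set \<Rightarrow> bool" where
  "no_isolated_vertex V E \<longleftrightarrow> (\<forall>v\<in>V. \<exists>e\<in>E. v \<in> e)"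

text \<open>For \<open>e = {a, b}\<close> and \<open>f = {x, y}\<close> this is \<open>{d(a,x), d(b,y), d(a,y), d(b,x)}\<close>.\<close>

definition Delta :: "'a set \<Rightarrow> 'a set set \<Rightarrow> 'a set \<Rightarrow> 'a set \<Rightarrow> enat set" where
  "Delta V E e f = {gdist V E u v | u v. u \<in> e \<and> v \<in> f}"

text \<open>
  Exchanging \<open>a\<close> and \<open>b\<close>, or \<open>x\<close> and \<open>y\<close>, swaps the two sides of the disequation, so
  the existential quantifier does not depend on how the end vertices are named.
\<close>

definition Theta :: "'a set \<Rightarrow> 'a set set \<Rightarrow> ('a set \<times> 'a set) set" where
  "Theta V E = {(e, f). e \<in> E \<and> f \<in> E \<and>
     (\<exists>a b x y. e = {a, b} \<and> f = {x, y} \<and>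
        gdist V E a x + gdist V E b y \<noteq> gdist V E a y + gdist V E b x)}"

definition Theta_bar :: "'a set \<Rightarrow> 'a set set \<Rightarrow> ('a set \<times> 'a set) set" where
  "Theta_bar V E = {(e, f). e \<in> E \<and> f \<in> E \<and> (e = f \<or> e \<noteq> f \<and> (e, f) \<notin> Theta V E)}"

definition one_trivial :: "'b set \<Rightarrow> ('b \<times> 'b) set \<Rightarrow> bool" where
  "one_trivial E R \<longleftrightarrow> card (E // R) = 1"

text \<open>
  ``Precisely \<open>|E|\<close> classes''. For infinite \<open>E\<close> this cannot be read as an equality of
  cardinals: the union of a 4-cycle and a ray starting at one of its vertices is not a
  tree, but its Djokovic-Winkler relation is an equivalence with as many classes as edges.
  There it means that every edge forms a class of its own, which for finite \<open>E\<close> is what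
  the equality of numbers amounts to.
\<close>

definition card_trivial :: "'b set \<Rightarrow> ('b \<times> 'b) set \<Rightarrow> bool" where
  "card_trivial E R \<longleftrightarrow>
     (if finite E then card (E // R) = card E else (\<forall>X \<in> E // R. is_singleton X))"

end

theory Submission
  imports Defs
begin

text \<open>
  For edges \<open>ab\<close> and \<open>xy\<close> the four distances in \<open>\<Delta>\<close> differ by at most one along either edge,
  so a pair in \<open>\<Theta>\<close> always has \<open>|\<Delta>| = 2\<close>. If every pair has \<open>|\<Delta>| = 2\<close>, then incident edges
  lie in triangles; hence vertices joined by a path are adjacent, and two disjoint edges
  would have \<open>\<Delta> = {1}\<close>.

  Along a cycle with closing edge \<open>ab\<close> the difference \<open>d(b,z) - d(a,z)\<close> changes from \<open>1\<close> to
  \<open>-1\<close>, and an edge of the cycle where it changes is in relation \<open>\<Theta>\<close> to \<open>ab\<close>. In a forest,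
  paths are unique, so a shortest path between two distinct edges extends by both edges to
  a shortest path, which gives \<open>\<Delta> = {k, k+1, k+2}\<close>.
\<close>

section \<open>Reflexive symmetric relations with extreme numbers of classes\<close>

text \<open>Reflexivity puts every \<open>f\<close> into its own class, so when there is a single
  class, \<open>f\<close> also lies in the class of any \<open>e\<close>. Since \<open>E\<close> is
  nonempty, \<open>E \<times> E\<close> does have a class, namely \<open>E\<close>.\<close>

lemma refl_sym_one_trivial_iff:
  assumes "refl_on E R" "R \<subseteq> E \<times> E" "sym R" "E \<noteq> {}"
  shows "R = R\<^sup>+ \<and> one_trivial E (R\<^sup>+) \<longleftrightarrow> R = E \<times> E"
proof
  assume *: "R = R\<^sup>+ \<and> one_trivial E (R\<^sup>+)"
  then have "card (E // R) = 1" unfolding one_trivial_def by metis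
  then obtain X where X: "E // R = {X}" by (auto simp: card_1_singleton_iff)
  have "(e, f) \<in> R" if "e \<in> E" "f \<in> E" for e f
  proof -
    have "R `` {e} = R `` {f}" using X that by (metis quotientI singletonD)
    then show ?thesis using refl_onD[OF assms(1) that(2)] by blast
  qed
  then show "R = E \<times> E" using assms(2) by auto
next
  assume R: "R = E \<times> E"
  then have "R\<^sup>+ = R" by (simp add: trans_def)
  moreover have "E // (E \<times> E) = {E}" using assms(4) by (auto simp: quotient_def)
  ultimately show "R = R\<^sup>+ \<and> one_trivial E (R\<^sup>+)" using R by (simp add: one_trivial_def)
qed

text \<open>By symmetry and transitivity, related elements have equal classes. For finite
  \<open>E\<close>, the map from elements to classes is onto a set of the same size, hence
  injective; for infinite \<open>E\<close>, reflexivity puts both related elements into one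
  singleton class.\<close>

lemma refl_sym_card_trivial_iff:
  assumes "refl_on E R" "R \<subseteq> E \<times> E" "sym R"
  shows "R = R\<^sup>+ \<and> card_trivial E (R\<^sup>+) \<longleftrightarrow> R = Id_on E"
proof
  assume *: "R = R\<^sup>+ \<and> card_trivial E (R\<^sup>+)"
  have quot: "E // R = (\<lambda>e. R `` {e}) ` E" by (auto simp: quotient_def)
  have same_class: "R `` {e} = R `` {f}" if "(e, f) \<in> R" for e f
  proof -
    have "trans R" using * by (metis trans_trancl)
    then show ?thesis using that assms(3) by (blast dest: symD transD)
  qed
  have "e = f" if ef: "(e, f) \<in> R" for e f
  proof (cases "finite E")
    case True
    then have "card ((\<lambda>e. R `` {e}) ` E) = card E"
      using * quot unfolding card_trivial_def by metis
    then have "inj_on (\<lambda>e. R `` {e}) E" using True by (simp add: eq_card_imp_inj_on)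
    then show ?thesis using same_class[OF ef] ef assms(2) by (auto dest: inj_onD)
  next
    case False
    have "R `` {e} \<in> E // R" using ef assms(2) by (auto simp: quotient_def)
    then have "is_singleton (R `` {e})" using * False unfolding card_trivial_def by metis
    moreover have "e \<in> R `` {e}" "f \<in> R `` {e}"
      using ef assms(1,2) by (auto dest: refl_onD)
    ultimately show ?thesis by (metis is_singletonE singletonD)
  qed
  then show "R = Id_on E" using assms(1,2) by (auto dest: refl_onD)
next
  assume R: "R = Id_on E"
  then have "trans R" by (auto intro: transI)
  then have "R\<^sup>+ = R" by (rule trancl_id)
  moreover have "E // Id_on E = (\<lambda>e. {e}) ` E" by (auto simp: quotient_def)
  moreover have "card ((\<lambda>e. {e}) ` E) = card E" by (simp add: card_image)
  ultimately show "R = R\<^sup>+ \<and> card_trivial E (R\<^sup>+)"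
    using R by (auto simp: card_trivial_def is_singleton_def)
qed

section \<open>Arithmetic of the four distances\<close>

text \<open>In the cyclic order \<open>p\<close>, \<open>q\<close>, \<open>s\<close>,
  \<open>r\<close>, neighbours differ by at most one. If an opposite pair differed by two, both
  remaining values would be its midpoint and the sums would agree; so all four lie in
  \<open>{m, Suc m}\<close>, with \<open>m\<close> their minimum, and are not all equal. One
  infinite value would make all four infinite and the sums equal.\<close>

lemma card_eq_2_of_unequal_sums:
  fixes p q r s :: enat
  assumes "p \<le> q + 1" "q \<le> p + 1" "r \<le> s + 1" "s \<le> r + 1"
    "p \<le> r + 1" "r \<le> p + 1" "q \<le> s + 1" "s \<le> q + 1"
    and "p + s \<noteq> q + r"
  shows "card {p, q, r, s} = 2"
proof -
  have fin: "p \<noteq> \<infinity>"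
  proof
    assume "p = \<infinity>"
    with assms(1,5) have "q = \<infinity>" "r = \<infinity>"
      by (cases q; cases r; simp add: one_enat_def)+
    with \<open>p = \<infinity>\<close> assms show False by simp
  qed
  then obtain a where a: "p = enat a" by auto
  have "q \<noteq> \<infinity>" "r \<noteq> \<infinity>" using a assms(2,6) by (auto simp: one_enat_def dest: enat_ile)
  then obtain b c where bc: "q = enat b" "r = enat c" by auto
  then have "s \<noteq> \<infinity>" using assms(4) by (auto simp: one_enat_def dest: enat_ile)
  then obtain d where d: "s = enat d" by auto
  have "a \<le> b + 1" "b \<le> a + 1" "c \<le> d + 1" "d \<le> c + 1"
    "a \<le> c + 1" "c \<le> a + 1" "b \<le> d + 1" "d \<le> b + 1" "a + d \<noteq> b + c"
    using assms unfolding a bc d by (auto simp: one_enat_def)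
  then have "\<exists>m. a \<in> {m, Suc m} \<and> b \<in> {m, Suc m} \<and> c \<in> {m, Suc m} \<and> d \<in> {m, Suc m}
      \<and> \<not> (a = b \<and> b = c \<and> c = d)"
    by (intro exI[of _ "min (min a b) (min c d)"]) auto
  then obtain m where "{a, b, c, d} = {m, Suc m}" by auto
  moreover have "{p, q, r, s} = enat ` {a, b, c, d}" unfolding a bc d by simp
  ultimately show ?thesis by simp
qed

section \<open>Uniqueness of paths in the absence of cycles\<close>

lemma successively_rev_sym:
  assumes "\<And>x y. P x y = P y x"
  shows "successively P (rev xs) = successively P xs"
  using assms by (simp add: successively_rev)

text \<open>Equal second vertices are settled by induction on the tails. If the second vertices
  differ, following one path until it first meets the other and returning along the latter closes a
  cycle at \<open>u\<close>.\<close>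

lemma acyclic_path_unique:
  assumes "\<nexists>c. cycle V E c" "path V E u p v" "path V E u q v"
  shows "p = q"
  using assms(2,3)
proof (induction p arbitrary: u q)
  case Nil
  then show ?case by (simp add: path_def)
next
  case (Cons u' p)
  then have [simp]: "u' = u" by (simp add: path_def)
  obtain q' where q: "q = u # q'" using Cons.prems(2) by (cases q) (auto simp: path_def)
  show ?case
  proof (cases "p = [] \<or> q' = []")
    case True
    then have "v = u" using Cons.prems unfolding q path_def by auto
    then have "p = []" "q' = []"
      using Cons.prems unfolding q path_def by (auto split: if_splits dest: last_in_set)
    then show ?thesis using q by simp
  next
    case False
    then have ne: "p \<noteq> []" "q' \<noteq> []" by auto
    have P: "path V E (hd p) p v" "{u, hd p} \<in> E" "u \<notin> set p" "u \<in> V"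
      using Cons.prems(1) ne by (auto simp: path_def successively_Cons)
    have Q: "path V E (hd q') q' v" "{u, hd q'} \<in> E" "u \<notin> set q'"
      using Cons.prems(2) ne unfolding q by (auto simp: path_def successively_Cons)
    show ?thesis
    proof (cases "hd p = hd q'")
      case True
      then show ?thesis using Cons.IH P(1) Q(1) q by auto
    next
      case False
      have "\<exists>w\<in>set p. w \<in> set q'"
        using P(1) Q(1) by (metis path_def last_in_set)
      \<comment> \<open>Taking the first vertex of \<open>p\<close> on \<open>q'\<close> keeps
        \<open>p1\<close> disjoint from \<open>q'\<close>, so that the cycle \<open>?c\<close> below
        has no repetition.\<close>
      then obtain p1 w p2 where p: "p = p1 @ w # p2" "w \<in> set q'" "\<forall>z\<in>set p1. z \<notin> set q'"
        using split_list_first_prop[of p "\<lambda>w. w \<in> set q'"] by blast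
      then obtain q1 q2 where q': "q' = q1 @ w # q2" by (meson split_list)
      let ?c = "u # p1 @ w # rev q1"
      \<comment> \<open>If both were empty, \<open>w\<close> would be the second vertex of both
        paths. Otherwise \<open>?c\<close> has a vertex besides \<open>u\<close> and
        \<open>w\<close>.\<close>
      have "p1 \<noteq> [] \<or> q1 \<noteq> []" using False p q' by auto
      then have "3 \<le> length ?c" by (cases p1; cases q1) auto
      moreover have "last ?c = hd q'" using q' by (cases q1) auto
      moreover have "distinct ?c" using P Q p q' by (auto simp: path_def)
      moreover have "set ?c \<subseteq> V" using P Q p q' by (auto simp: path_def)
      moreover have "successively (\<lambda>x y. {x, y} \<in> E) ?c"
      proof -
        have s: "successively (\<lambda>x y. {x, y} \<in> E) (p1 @ [w])"
          using P(1) unfolding p path_def by (auto simp: successively_append_iff)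
        have "successively (\<lambda>x y. {x, y} \<in> E) (q1 @ [w])"
          using Q(1) unfolding q' path_def by (auto simp: successively_append_iff)
        then have "successively (\<lambda>x y. {x, y} \<in> E) (rev (q1 @ [w]))"
          by (subst successively_rev_sym) (auto simp: insert_commute)
        with s have "successively (\<lambda>x y. {x, y} \<in> E) (p1 @ w # rev q1)"
          by (cases "rev q1") (auto simp: successively_append_iff)
        moreover have "hd (p1 @ w # rev q1) = hd p" using p by (cases p1) auto
        ultimately show ?thesis using P(2) by (simp add: successively_Cons)
      qed
      ultimately have "cycle V E ?c"
        using Q(2) unfolding cycle_def path_def by (simp add: insert_commute)
      then show ?thesis using assms(1) by blast
    qed
  qed
qed

section \<open>Paths and distances in a simple graph\<close>

locale simple_graph =
  fixes V :: "'a set" and E :: "'a set set"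
  assumes graph: "graph V E"
begin

abbreviation d :: "'a \<Rightarrow> 'a \<Rightarrow> enat" where
  "d \<equiv> gdist V E"

lemma edgeD:
  assumes "{u, v} \<in> E"
  shows "u \<in> V" "v \<in> V" "u \<noteq> v"
proof -
  obtain x y where "{u, v} = {x, y}" "x \<in> V" "y \<in> V" "x \<noteq> y"
    using assms graph unfolding graph_def by blast
  then show "u \<in> V" "v \<in> V" "u \<noteq> v" by (auto simp: doubleton_eq_iff)
qed

lemma edge_sym: "{u, v} \<in> E \<Longrightarrow> {v, u} \<in> E"
  by (simp add: insert_commute)

lemma edgeE:
  assumes "e \<in> E"
  obtains u v where "e = {u, v}" "u \<noteq> v" "u \<in> V" "v \<in> V"
  using assms graph unfolding graph_def by blast

lemma edge_otherE:
  assumes "e \<in> E" "u \<in> e"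
  obtains v where "e = {u, v}"
proof -
  obtain x y where "e = {x, y}" using assms(1) by (rule edgeE)
  then show thesis using assms(2) that[of x] that[of y] by (auto simp: insert_commute)
qed

lemma path_rev: "path V E u p v \<Longrightarrow> path V E v (rev p) u"
  unfolding path_def
  by (auto simp: hd_rev last_rev successively_rev_sym insert_commute)

lemma path_Cons:
  assumes "path V E u p v" "{w, u} \<in> E" "w \<notin> set p"
  shows "path V E w (w # p) v"
  using assms edgeD[OF assms(2)] by (auto simp: path_def successively_Cons)

lemma path_suffix:
  assumes "path V E u (p @ w # q) v"
  shows "path V E w (w # q) v"
  using assms by (auto simp: path_def successively_append_iff)

lemma gdist_le: "path V E u p v \<Longrightarrow> d u v \<le> enat (length p - 1)"
  unfolding gdist_def by (rule INF_lower) simp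

text \<open>The order on \<open>enat\<close> is a well-order, so the infimum of a nonempty set is
  its minimum; the empty set would give \<infinity>.\<close>

lemma gdist_attained:
  assumes "d u v \<noteq> \<infinity>"
  obtains p where "path V E u p v" "d u v = enat (length p - 1)"
proof -
  let ?L = "(\<lambda>p. enat (length p - 1)) ` {p. path V E u p v}"
  have "?L \<noteq> {}"
  proof
    assume "?L = {}"
    then have "d u v = Inf {}" unfolding gdist_def by metis
    then show False using assms by (simp add: top_enat_def)
  qed
  then have "Inf ?L \<in> ?L" by (auto simp: Inf_enat_def intro: LeastI)
  then show thesis using that by (auto simp: gdist_def)
qed

lemma gdist_sym: "d u v = d v u"
proof -
  have "d u v \<le> d v u" for u v
  proof (cases "d v u = \<infinity>")
    case False
    then obtain p where "path V E v p u" "d v u = enat (length p - 1)" by (rule gdist_attained)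
    then show ?thesis using gdist_le[OF path_rev] by fastforce
  qed simp
  then show ?thesis by (simp add: antisym)
qed

lemma gdist_self: "u \<in> V \<Longrightarrow> d u u = 0"
  using gdist_le[of u "[u]" u] by (simp add: path_def flip: zero_enat_def)

lemma gdist_eq_0_imp_eq:
  assumes "d u v = 0"
  shows "u = v"
proof -
  obtain p where "path V E u p v" "d u v = enat (length p - 1)"
    using assms by (metis gdist_attained zero_enat_def infinity_ne_i0)
  then show ?thesis using assms by (cases p) (auto simp: path_def zero_enat_def)
qed

lemma gdist_eq_1_iff: "d u v = 1 \<longleftrightarrow> {u, v} \<in> E"
proof
  assume 1: "d u v = 1"
  then obtain p where "path V E u p v" "d u v = enat (length p - 1)"
    by (metis gdist_attained one_enat_def enat.distinct(2))
  moreover from this 1 have "length p = Suc (Suc 0)" by (simp add: one_enat_def)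
  ultimately show "{u, v} \<in> E" by (auto simp: path_def length_Suc_conv)
next
  assume uv: "{u, v} \<in> E"
  then have "path V E u [u, v] v" using edgeD[OF uv] by (auto simp: path_def)
  then have "d u v \<le> 1" using gdist_le by (fastforce simp: one_enat_def)
  moreover have "d u v \<noteq> 0" using gdist_eq_0_imp_eq edgeD(3)[OF uv] by blast
  ultimately show "d u v = 1" by (metis ileI1 antisym one_eSuc zero_less_iff_neq_zero)
qed

text \<open>Prepending \<open>b\<close> to a shortest path from \<open>a\<close> lengthens it by
  one. As paths repeat no vertex, this fails if \<open>b\<close> already lies on the path, but then
  its suffix from \<open>b\<close> serves instead.\<close>

lemma gdist_edge_le:
  assumes "{a, b} \<in> E"
  shows "d b x \<le> d a x + 1"
proof (cases "d a x = \<infinity>")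
  case False
  then obtain p where p: "path V E a p x" "d a x = enat (length p - 1)" by (rule gdist_attained)
  have ne: "p \<noteq> []" using p(1) by (simp add: path_def)
  show ?thesis
  proof (cases "b \<in> set p")
    case True
    then obtain p1 p2 where "p = p1 @ b # p2" by (meson split_list)
    then have "d b x \<le> enat (length (b # p2) - 1)" "length (b # p2) \<le> length p"
      using path_suffix gdist_le p(1) by (blast, simp)
    then have "d b x \<le> d a x" using p(2) by (auto elim!: order_trans)
    then show ?thesis by (meson order_trans le_iff_add)
  next
    case False
    then have "d b x \<le> enat (length (b # p) - 1)"
      using path_Cons[OF p(1)] assms gdist_le by (metis insert_commute)
    then show ?thesis using p(2) ne by (cases p) (auto simp: one_enat_def)
  qed
qed simp

lemma gdist_edge_le':
  assumes "{x, y} \<in> E"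
  shows "d a y \<le> d a x + 1"
  using gdist_edge_le[OF assms] by (simp add: gdist_sym)

section \<open>The relations \<open>Theta\<close> and \<open>Theta_bar\<close>\<close>

lemma Delta_doubleton:
  "Delta V E {a, b} {x, y} = {d a x, d a y, d b x, d b y}"
  unfolding Delta_def by auto

lemma Theta_doubleton_iff:
  "({a, b}, {x, y}) \<in> Theta V E \<longleftrightarrow>
     {a, b} \<in> E \<and> {x, y} \<in> E \<and> d a x + d b y \<noteq> d a y + d b x"
  unfolding Theta_def by (auto simp: doubleton_eq_iff add.commute)

lemma Theta_subset: "Theta V E \<subseteq> E \<times> E"
  unfolding Theta_def by auto

lemma sym_Theta: "sym (Theta V E)"
proof (rule symI)
  fix e f assume ef: "(e, f) \<in> Theta V E"
  then obtain a b x y where "e = {a, b}" "f = {x, y}"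
    unfolding Theta_def by auto
  with ef show "(f, e) \<in> Theta V E"
    by (simp add: Theta_doubleton_iff gdist_sym[of x] gdist_sym[of y] add.commute)
qed

text \<open>For \<open>f = e\<close> the two sums are 0 and 2.\<close>

lemma refl_on_Theta: "refl_on E (Theta V E)"
proof (rule refl_onI)
  fix e assume e: "e \<in> E"
  then obtain a b where ab: "e = {a, b}" "a \<in> V" "b \<in> V" by (metis edgeE)
  moreover have "d a b = 1" "d b a = 1" using e ab gdist_eq_1_iff by (auto simp: insert_commute)
  ultimately show "(e, e) \<in> Theta V E"
    using e by (simp add: Theta_doubleton_iff gdist_self)
qed

lemma Theta_bar_subset: "Theta_bar V E \<subseteq> E \<times> E"
  unfolding Theta_bar_def by auto

lemma sym_Theta_bar: "sym (Theta_bar V E)"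
  using sym_Theta unfolding sym_def Theta_bar_def by auto

lemma refl_on_Theta_bar: "refl_on E (Theta_bar V E)"
  by (rule refl_onI) (auto simp: Theta_bar_def)

text \<open>Within \<open>E \<times> E\<close> both relations contain the diagonal and are
  complementary off it, so one is everything exactly when the other is the diagonal.\<close>

lemma Theta_eq_Times_iff: "Theta V E = E \<times> E \<longleftrightarrow> Theta_bar V E = Id_on E"
proof -
  have "Theta V E = E \<times> E \<longleftrightarrow> (\<forall>e\<in>E. \<forall>f\<in>E. e \<noteq> f \<longrightarrow> (e, f) \<in> Theta V E)"
  proof
    assume *: "\<forall>e\<in>E. \<forall>f\<in>E. e \<noteq> f \<longrightarrow> (e, f) \<in> Theta V E"
    have "(e, f) \<in> Theta V E" if "e \<in> E" "f \<in> E" for e f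
      using * that refl_onD[OF refl_on_Theta] by (cases "e = f") simp_all
    then show "Theta V E = E \<times> E" using Theta_subset by auto
  qed simp
  also have "\<dots> \<longleftrightarrow> Theta_bar V E = Id_on E"
    unfolding Theta_bar_def by auto
  finally show ?thesis .
qed

lemma Theta_eq_Id_on_iff: "Theta V E = Id_on E \<longleftrightarrow> Theta_bar V E = E \<times> E"
proof -
  have "Theta V E = Id_on E \<longleftrightarrow> (\<forall>e\<in>E. \<forall>f\<in>E. e \<noteq> f \<longrightarrow> (e, f) \<notin> Theta V E)"
  proof
    assume *: "\<forall>e\<in>E. \<forall>f\<in>E. e \<noteq> f \<longrightarrow> (e, f) \<notin> Theta V E"
    have "Theta V E \<subseteq> Id_on E" using * Theta_subset by fast
    moreover have "Id_on E \<subseteq> Theta V E"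
      using refl_onD[OF refl_on_Theta] by auto
    ultimately show "Theta V E = Id_on E" by (rule antisym)
  qed auto
  also have "\<dots> \<longleftrightarrow> Theta_bar V E = E \<times> E"
    unfolding Theta_bar_def by auto
  finally show ?thesis .
qed

lemma card_Delta_of_Theta:
  assumes "(e, f) \<in> Theta V E"
  shows "card (Delta V E e f) = 2"
proof -
  obtain a b x y where ef: "e = {a, b}" "f = {x, y}" using assms unfolding Theta_def by auto
  have ab: "{a, b} \<in> E" "{b, a} \<in> E" and xy: "{x, y} \<in> E" "{y, x} \<in> E"
    and ne: "d a x + d b y \<noteq> d a y + d b x"
    using assms unfolding ef Theta_doubleton_iff by (auto simp: insert_commute)
  have "card {d a x, d a y, d b x, d b y} = 2"
    by (rule card_eq_2_of_unequal_sums[OF _ _ _ _ _ _ _ _ ne])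
      (use ab xy gdist_edge_le gdist_edge_le' in auto)
  then show ?thesis unfolding ef Delta_doubleton .
qed

section \<open>Two-valued distance sets and the graphs \<open>K_2\<close> and
  \<open>K_3\<close>\<close>

text \<open>Pairwise intersecting edges closed under completing triangles form a single edge or one
  triangle. The vertex set \<open>W\<close> is existential because isolated vertices of
  \<open>V\<close> leave no trace in the hypothesis.\<close>

lemma complete_graph_if_card_Delta_eq_2:
  assumes "E \<noteq> {}" and 2: "\<forall>e\<in>E. \<forall>f\<in>E. e \<noteq> f \<longrightarrow> card (Delta V E e f) = 2"
  shows "\<exists>W. complete_graph 2 W E \<or> complete_graph 3 W E"
proof -
  \<comment> \<open>Here \<open>Delta\<close> is \<open>{0, 1, d b c}\<close>, so having two
    elements leaves only \<open>d b c = 1\<close>, as \<open>b \<noteq> c\<close>.\<close>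
  have triangle: "{b, c} \<in> E" if ab: "{a, b} \<in> E" and ac: "{a, c} \<in> E" and "b \<noteq> c" for a b c
  proof -
    have "card (Delta V E {a, b} {a, c}) = 2"
      by (rule 2[rule_format, OF ab ac]) (use \<open>b \<noteq> c\<close> in \<open>simp add: doubleton_eq_iff\<close>)
    moreover have "d a a = 0" "d a c = 1" "d b a = 1"
      using ab ac edgeD(1)[OF ab] by (simp_all add: gdist_self gdist_eq_1_iff edge_sym)
    ultimately have "card {0, 1, d b c} = 2" by (simp add: Delta_doubleton)
    moreover have "d b c \<noteq> 0" using gdist_eq_0_imp_eq \<open>b \<noteq> c\<close> by blast
    ultimately have "d b c = 1" by (auto simp: card_insert_if split: if_splits)
    then show ?thesis by (simp add: gdist_eq_1_iff)
  qed
  have adjacent: "u = v \<or> {u, v} \<in> E" if "path V E u p v" for u v p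
    using that
  proof (induction p arbitrary: u)
    case Nil
    then show ?case by (simp add: path_def)
  next
    case (Cons u' p)
    then have [simp]: "u' = u" by (simp add: path_def)
    show ?case
    proof (cases "p = []")
      case True
      then show ?thesis using Cons.prems by (simp add: path_def)
    next
      case False
      then have "path V E (hd p) p v" "{u, hd p} \<in> E"
        using Cons.prems by (auto simp: path_def successively_Cons)
      \<comment> \<open>By induction \<open>hd p\<close> equals or is adjacent to \<open>v\<close>;
        in the latter case the triangle at \<open>hd p\<close> joins \<open>u\<close> and
        \<open>v\<close>.\<close>
      then show ?thesis using Cons.IH[of "hd p"] triangle[of "hd p" u v] edge_sym by metis
    qed
  qed
  have meet: "e \<inter> f \<noteq> {}" if e: "e \<in> E" and f: "f \<in> E" for e f
  proof
    assume disj: "e \<inter> f = {}"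
    obtain a b where ab: "e = {a, b}" using e by (metis edgeE)
    obtain x y where xy: "f = {x, y}" using f by (metis edgeE)
    have "e \<noteq> f" using disj ab by auto
    with e f have card: "card (Delta V E e f) = 2" by (rule 2[rule_format])
    \<comment> \<open>One finite distance yields an edge between \<open>e\<close> and
      \<open>f\<close>, which spreads to all four pairs of ends and makes every distance 1;
      otherwise every distance is infinite.\<close>
    have "d u v = d a x" if u: "u \<in> e" and v: "v \<in> f" for u v
    proof (cases "\<exists>u\<in>e. \<exists>v\<in>f. d u v \<noteq> \<infinity>")
      case True
      then obtain u' v' where u'v': "u' \<in> e" "v' \<in> f" "d u' v' \<noteq> \<infinity>" by blast
      then have u'v'_edge: "{u', v'} \<in> E" using gdist_attained adjacent disj by (metis disjoint_iff)
      have sames: "s = s' \<or> {s, s'} \<in> E" if "s \<in> e" "s' \<in> e" for s s'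
        using that e ab edge_sym by auto
      have samet: "t = t' \<or> {t, t'} \<in> E" if "t \<in> f" "t' \<in> f" for t t'
        using that f xy edge_sym by auto
      \<comment> \<open>The edge from \<open>u'\<close> to \<open>v'\<close> is moved one end at a
        time, first \<open>u'\<close> to \<open>s\<close> and then \<open>v'\<close> to
        \<open>t\<close>.\<close>
      have "{s, t} \<in> E" if "s \<in> e" "t \<in> f" for s t
      proof -
        have "s \<noteq> v'" "s \<noteq> t" using that u'v'(2) disj by auto
        have "{s, v'} \<in> E"
          using triangle[of u' s v'] \<open>s \<noteq> v'\<close> sames[OF that(1) u'v'(1)] u'v'_edge edge_sym by blast
        then show ?thesis
          using triangle[of v' s t] \<open>s \<noteq> t\<close> samet[OF that(2) u'v'(2)] edge_sym by blast
      qed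
      then have "d s t = 1" if "s \<in> e" "t \<in> f" for s t
        using that by (simp add: gdist_eq_1_iff)
      then show ?thesis using u v ab xy by simp
    next
      case False
      then show ?thesis using u v ab xy by auto
    qed
    then have "d a y = d a x" "d b x = d a x" "d b y = d a x" unfolding ab xy by blast+
    then have "Delta V E e f = {d a x}" using ab xy by (simp add: Delta_doubleton)
    then show False using card by simp
  qed
  obtain e where e: "e \<in> E" using \<open>E \<noteq> {}\<close> by blast
  then obtain a b where ab: "e = {a, b}" "a \<noteq> b" by (metis edgeE)
  show ?thesis
  proof (cases "E = {e}")
    case True
    then have "complete_graph 2 {a, b} E" using ab by (auto simp: complete_graph_def doubleton_eq_iff)
    then show ?thesis by blast
  next
    case False
    then obtain f where f: "f \<in> E" "f \<noteq> e" using e by blast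
    obtain a b c where abc: "e = {a, b}" "f = {a, c}"
    proof -
      obtain z where "z \<in> e" "z \<in> f" using meet[OF e f(1)] by blast
      then show thesis using that e f(1) by (metis edge_otherE)
    qed
    have "b \<noteq> c" using abc f by auto
    then have bc: "{b, c} \<in> E" using triangle abc e f by blast
    have ne: "a \<noteq> b" "a \<noteq> c" using abc e f edgeD by blast+
    \<comment> \<open>An edge meets all three sides of the triangle. With one end outside, its other
      end would have to lie on all three sides, which no vertex does.\<close>
    have "E \<subseteq> {{u, v} |u v. u \<in> {a, b, c} \<and> v \<in> {a, b, c} \<and> u \<noteq> v}"
    proof
      fix g assume g: "g \<in> E"
      obtain s t where st: "g = {s, t}" "s \<noteq> t" using g by (metis edgeE)
      have "s \<in> {a, b} \<or> t \<in> {a, b}" "s \<in> {a, c} \<or> t \<in> {a, c}" "s \<in> {b, c} \<or> t \<in> {b, c}"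
        using meet[OF g e] meet[OF g f(1)] meet[OF g bc] unfolding st abc by blast+
      then have "s \<in> {a, b, c}" "t \<in> {a, b, c}" using ne \<open>b \<noteq> c\<close> by auto
      with st show "g \<in> {{u, v} |u v. u \<in> {a, b, c} \<and> v \<in> {a, b, c} \<and> u \<noteq> v}" by blast
    qed
    moreover have "{u, v} \<in> E" if "u \<in> {a, b, c}" "v \<in> {a, b, c}" "u \<noteq> v" for u v
      using that e f bc edge_sym unfolding abc by blast
    ultimately have "complete_graph 3 {a, b, c} E"
      using ne \<open>b \<noteq> c\<close> unfolding complete_graph_def by auto
    then show ?thesis by blast
  qed
qed

text \<open>Two distinct edges on at most three vertices share an end \<open>u\<close>. With other
  ends \<open>v\<close> and \<open>w\<close> the sums are \<open>d u u + d v w = 1\<close> and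
  \<open>d u w + d v u = 2\<close>.\<close>

lemma Theta_if_complete_graph:
  assumes "complete_graph 2 W E \<or> complete_graph 3 W E" "e \<in> E" "f \<in> E"
  shows "(e, f) \<in> Theta V E"
proof (cases "e = f")
  case True
  then show ?thesis using assms(2) refl_on_Theta by (auto dest: refl_onD)
next
  case False
  have W: "finite W" "card W \<le> 3" "E = {{u, v} |u v. u \<in> W \<and> v \<in> W \<and> u \<noteq> v}"
    using assms(1) by (auto simp: complete_graph_def)
  obtain a b where ab: "e = {a, b}" "a \<noteq> b" "a \<in> W" "b \<in> W" using assms(2) W(3) by blast
  obtain x y where xy: "f = {x, y}" "x \<noteq> y" "x \<in> W" "y \<in> W" using assms(3) W(3) by blast
  have "e \<inter> f \<noteq> {}"
  proof
    assume "e \<inter> f = {}"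
    then have "card {a, b, x, y} = 4" using ab xy by auto
    moreover have "card {a, b, x, y} \<le> card W" using ab xy W(1) by (intro card_mono) auto
    ultimately show False using W(2) by simp
  qed
  then obtain u v w where uvw: "e = {u, v}" "f = {u, w}"
    using assms(2,3) by (metis disjoint_iff edge_otherE)
  then have vw: "v \<in> W" "w \<in> W" using ab xy by auto
  have "v \<noteq> w" using uvw False by auto
  then have "{v, w} \<in> E" using vw W(3) by blast
  then have "d v w = 1" by (simp add: gdist_eq_1_iff)
  moreover have "d u w = 1" "d v u = 1" "d u u = 0"
    using assms(2,3) edgeD(1)[of u v] unfolding uvw
    by (simp_all add: gdist_self gdist_eq_1_iff edge_sym)
  ultimately show ?thesis using assms(2,3) unfolding uvw by (simp add: Theta_doubleton_iff)
qed

text \<open>This replaces the existential \<open>W\<close> by \<open>V\<close>: vertices of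
  \<open>V\<close> lie on edges and hence in \<open>W\<close>, and since an edge gives
  \<open>W\<close> two vertices, each vertex of \<open>W\<close> lies on an edge too.\<close>

lemma complete_graph_vertices:
  assumes "no_isolated_vertex V E" "E \<noteq> {}" "complete_graph n W E"
  shows "W = V"
proof
  show "V \<subseteq> W"
    using assms(1,3) unfolding no_isolated_vertex_def complete_graph_def by blast
  obtain a b where ab: "a \<in> W" "b \<in> W" "a \<noteq> b"
    using assms(2,3) unfolding complete_graph_def by blast
  show "W \<subseteq> V"
  proof
    fix w assume w: "w \<in> W"
    obtain u where "u \<in> W" "u \<noteq> w" using ab by metis
    then have "{w, u} \<in> E" using w assms(3) by (auto simp: complete_graph_def)
    then show "w \<in> V" by (rule edgeD)
  qed
qed

section \<open>Cycles and forests\<close>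

lemma cycle_Theta:
  assumes "cycle V E p"
  shows "\<exists>e f. e \<noteq> f \<and> (e, f) \<in> Theta V E"
proof (rule ccontr)
  assume no: "\<nexists>e f. e \<noteq> f \<and> (e, f) \<in> Theta V E"
  have nT: "e = f" if "(e, f) \<in> Theta V E" for e f
    using that no by blast
  define a b where "a = hd p" and "b = last p"
  have len: "3 \<le> length p" and ab: "{a, b} \<in> E" and dist: "distinct p"
    and succ: "\<And>i. Suc i < length p \<Longrightarrow> {p ! i, p ! Suc i} \<in> E"
    using assms unfolding cycle_def path_def a_def b_def successively_conv_nth
    by (auto intro: edge_sym)
  have a: "a = p ! 0" and b: "b = p ! (length p - 1)"
    using len hd_conv_nth[of p] last_conv_nth[of p] unfolding a_def b_def by fastforce+
  \<comment> \<open>If no two distinct edges were related, this invariant would pass from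
    \<open>a\<close> along the whole cycle to \<open>b\<close>, where it says \<open>0 = 2\<close>.
    Finiteness is carried along because cancellation in \<open>enat\<close> needs it.\<close>
  have "d a (p ! i) \<noteq> \<infinity> \<and> d b (p ! i) = d a (p ! i) + 1" if "i < length p" for i
    using that
  proof (induction i)
    case 0
    have "d b a = 1" using ab by (simp add: gdist_eq_1_iff edge_sym)
    then show ?case using edgeD[OF ab] by (simp add: gdist_self flip: a)
  next
    case (Suc i)
    define x y where "x = p ! i" and "y = p ! Suc i"
    have IH: "d a x \<noteq> \<infinity>" "d b x = d a x + 1" using Suc x_def by auto
    have xy: "{x, y} \<in> E" using succ Suc.prems x_def y_def by simp
    \<comment> \<open>The vertex \<open>b\<close> occurs only at the last index and \<open>a\<close>
      only at index 0, so equality would force \<open>x = a\<close>, \<open>y = b\<close> and a list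
      of length two.\<close>
    have "{a, b} \<noteq> {x, y}"
    proof -
      have "x \<noteq> b" using dist Suc.prems len unfolding x_def b by (auto simp: nth_eq_iff_index_eq)
      moreover have "y \<noteq> a" using dist Suc.prems len unfolding y_def a
        by (metis Suc_lessD nat.distinct(1) nth_eq_iff_index_eq zero_less_Suc less_trans)
      moreover have "x \<noteq> a \<or> y \<noteq> b"
      proof (rule ccontr)
        assume "\<not> (x \<noteq> a \<or> y \<noteq> b)"
        then have "i = 0" "Suc i = length p - 1"
          using nth_eq_iff_index_eq[OF dist, of i 0] nth_eq_iff_index_eq[OF dist, of "Suc i" "length p - 1"]
              Suc.prems len unfolding x_def y_def a b by (auto simp del: length_greater_0_conv)
        then show False using len by simp
      qed
      ultimately show ?thesis by (auto simp: doubleton_eq_iff)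
    qed
    then have eq: "d a x + d b y = d a y + d b x"
      using nT ab xy Theta_doubleton_iff by blast
    have "d a y \<noteq> \<infinity>" using gdist_edge_le'[OF xy, of a] IH(1) by (auto simp: one_enat_def dest: enat_ile)
    moreover have "d b y = d a y + 1" using eq IH by (cases "d a x"; cases "d a y"; cases "d b y")
        (auto simp: one_enat_def)
    ultimately show ?case by (simp add: y_def)
  qed
  from this[of "length p - 1"] have "d b b = d a b + 1" using len b by simp
  then show False using edgeD[OF ab] by (simp add: gdist_self)
qed

text \<open>A shortest path exists and, by uniqueness, is \<open>p\<close> itself.\<close>

lemma acyclic_gdist:
  assumes "\<nexists>c. cycle V E c" "path V E u p v"
  shows "d u v = enat (length p - 1)"
proof -
  have "d u v \<noteq> \<infinity>" using gdist_le[OF assms(2)] by (cases "d u v") auto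
  then show ?thesis using gdist_attained acyclic_path_unique[OF assms] by metis
qed

lemma acyclic_card_Delta:
  assumes "\<nexists>c. cycle V E c" "e \<in> E" "f \<in> E" "e \<noteq> f" "\<exists>u\<in>e. \<exists>v\<in>f. d u v \<noteq> \<infinity>"
  shows "card (Delta V E e f) = 3"
proof -
  \<comment> \<open>A shortest path over all choices of ends is taken. It avoids \<open>b\<close>
    and \<open>y\<close>, since cutting it off at such a vertex would give a shorter admissible
    path.\<close>
  define P where "P p \<longleftrightarrow> (\<exists>u\<in>e. \<exists>v\<in>f. path V E u p v)" for p
  have "\<exists>p. P p" using assms(5) gdist_attained unfolding P_def by metis
  then obtain p where "P p" and least: "\<And>q. P q \<Longrightarrow> length p \<le> length q"
    by (metis ex_has_least_nat)
  then obtain a x where a: "a \<in> e" and x: "x \<in> f" and p: "path V E a p x" by (auto simp: P_def)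
  obtain b where e: "e = {a, b}" using assms(2) a by (rule edge_otherE)
  obtain y where f: "f = {x, y}" using assms(3) x by (rule edge_otherE)
  have ab: "{b, a} \<in> E" and xy: "{y, x} \<in> E" using e f assms(2,3) by (auto simp: insert_commute)
  have b: "b \<notin> set p"
  proof
    assume "b \<in> set p"
    then obtain q r where qr: "p = q @ b # r" by (meson split_list)
    then have "P (b # r)" using path_suffix p e x unfolding P_def by blast
    then have "q = []" using least[of "b # r"] qr by simp
    then show False using qr p edgeD(3)[OF ab] by (simp add: path_def)
  qed
  have y: "y \<notin> set p"
  proof
    assume "y \<in> set p"
    then obtain q r where qr: "rev p = q @ y # r" by (metis set_rev split_list)
    then have "path V E y (y # r) a" using path_suffix path_rev[OF p] by metis
    then have "P (rev (y # r))" using path_rev e f unfolding P_def by blast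
    then have "length (rev p) \<le> length (y # r)" using least by fastforce
    then have "q = []" using qr by simp
    then show False using qr path_rev[OF p] edgeD(3)[OF xy] by (simp add: path_def)
  qed
  \<comment> \<open>A common end \<open>b\<close> would make \<open>[b]\<close> admissible, so
    \<open>p\<close> would be a single vertex, \<open>a = x\<close>, and the edges would
    coincide.\<close>
  have "y \<noteq> b"
  proof
    assume "y = b"
    then have "path V E b [b] b" "b \<in> e" "b \<in> f" using edgeD[OF ab] e f by (auto simp: path_def)
    then have "length p \<le> 1" using least[of "[b]"] unfolding P_def by auto
    then have "a = x" using p by (cases p) (auto simp: path_def)
    then show False using \<open>y = b\<close> e f assms(4) by simp
  qed
  have bx: "path V E b (b # p) x" using path_Cons[OF p ab b] .
  have ya: "path V E y (y # rev p) a" using path_Cons[OF path_rev[OF p] xy] y by simp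
  have yb: "path V E y (y # rev (b # p)) b"
    using path_Cons[OF path_rev[OF bx] xy] y \<open>y \<noteq> b\<close> by simp
  define k where "k = length p - 1"
  have len: "length p = Suc k" using p by (cases p) (auto simp: path_def k_def)
  have "d a x = enat k" "d b x = enat (k + 1)" "d a y = enat (k + 1)" "d b y = enat (k + 2)"
    using acyclic_gdist[OF assms(1) p] acyclic_gdist[OF assms(1) bx]
      acyclic_gdist[OF assms(1) ya] acyclic_gdist[OF assms(1) yb] gdist_sym[of y] len by auto
  then show ?thesis unfolding e f Delta_doubleton by simp
qed

text \<open>Edges in different components have \<open>Delta\<close> equal to
  \<open>{\<infinity>}\<close>; this is the case that separates the value 3 from merely not being
  2.\<close>

lemma card_Delta_infinite:
  assumes "e \<in> E" "f \<in> E" "\<forall>u\<in>e. \<forall>v\<in>f. d u v = \<infinity>"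
  shows "card (Delta V E e f) = 1"
proof -
  obtain a b where "e = {a, b}" using assms(1) by (metis edgeE)
  moreover obtain x y where "f = {x, y}" using assms(2) by (metis edgeE)
  ultimately show ?thesis using assms(3) by (simp add: Delta_doubleton)
qed

end

text \<open>Without edges there are no classes, so \<open>A1\<close> would fail while
  \<open>A2\<close> holds. Isolated vertices affect \<open>A3\<close> but not \<open>A4\<close>. A
  disconnected forest satisfies \<open>B4\<close> without being a tree, and its edges in different
  components violate \<open>B4'\<close>.\<close>

theorem lemma3p4:
  fixes V :: "'a set" and E :: "'a set set"
  assumes "graph V E" and "E \<noteq> {}"
  defines "A1 \<equiv> Theta V E = (Theta V E)\<^sup>+ \<and> one_trivial E ((Theta V E)\<^sup>+)"
      and "A2 \<equiv> Theta_bar V E = (Theta_bar V E)\<^sup>+ \<and> card_trivial E ((Theta_bar V E)\<^sup>+)"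
      and "A3 \<equiv> complete_graph 2 V E \<or> complete_graph 3 V E"
      and "A4 \<equiv> (\<forall>e\<in>E. \<forall>f\<in>E. e \<noteq> f \<longrightarrow> card (Delta V E e f) = 2)"
      and "B1 \<equiv> Theta V E = (Theta V E)\<^sup>+ \<and> card_trivial E ((Theta V E)\<^sup>+)"
      and "B2 \<equiv> Theta_bar V E = (Theta_bar V E)\<^sup>+ \<and> one_trivial E ((Theta_bar V E)\<^sup>+)"
      and "B3 \<equiv> tree V E"
      and "B4 \<equiv> (\<forall>e\<in>E. \<forall>f\<in>E. e \<noteq> f \<longrightarrow> card (Delta V E e f) \<noteq> 2)"
      and "B4' \<equiv> (\<forall>e\<in>E. \<forall>f\<in>E. e \<noteq> f \<longrightarrow> card (Delta V E e f) = 3)"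
  shows "((A1 \<longleftrightarrow> A2) \<and> (A2 \<longleftrightarrow> A4) \<and> (no_isolated_vertex V E \<longrightarrow> (A3 \<longleftrightarrow> A4)))
       \<and> ((B1 \<longleftrightarrow> B2) \<and> (B2 \<longleftrightarrow> B4) \<and>
          (connected_graph V E \<longrightarrow> (B3 \<longleftrightarrow> B4) \<and> (B4 \<longleftrightarrow> B4')))"
proof -
  interpret simple_graph V E by unfold_locales (rule assms)
  note rel = refl_on_Theta Theta_subset sym_Theta
    and rel_bar = refl_on_Theta_bar Theta_bar_subset sym_Theta_bar
  have A1: "A1 \<longleftrightarrow> Theta V E = E \<times> E"
    unfolding A1_def by (rule refl_sym_one_trivial_iff[OF rel \<open>E \<noteq> {}\<close>])
  have A2: "A2 \<longleftrightarrow> Theta V E = E \<times> E"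
    unfolding A2_def Theta_eq_Times_iff by (rule refl_sym_card_trivial_iff[OF rel_bar])
  have A4: "A4 \<longleftrightarrow> (\<exists>W. complete_graph 2 W E \<or> complete_graph 3 W E)"
    unfolding A4_def using complete_graph_if_card_Delta_eq_2[OF \<open>E \<noteq> {}\<close>]
      card_Delta_of_Theta[OF Theta_if_complete_graph] by blast
  have "A2 \<longleftrightarrow> A4"
  proof
    assume A2
    then show A4 unfolding A2 A4_def by (simp add: card_Delta_of_Theta)
  next
    assume A4
    then show A2 unfolding A2 A4 using Theta_if_complete_graph Theta_subset by blast
  qed
  moreover have "A3 \<longleftrightarrow> A4" if "no_isolated_vertex V E"
    unfolding A3_def A4 using complete_graph_vertices[OF that \<open>E \<noteq> {}\<close>] by blast
  moreover have B1: "B1 \<longleftrightarrow> Theta V E = Id_on E"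
    unfolding B1_def by (rule refl_sym_card_trivial_iff[OF rel])
  moreover have "B2 \<longleftrightarrow> Theta V E = Id_on E"
    unfolding B2_def Theta_eq_Id_on_iff by (rule refl_sym_one_trivial_iff[OF rel_bar \<open>E \<noteq> {}\<close>])
  \<comment> \<open>The circle from \<open>B1\<close> to acyclicity to \<open>B4\<close> and back
    holds for every graph with edges; connectedness enters afterwards, to pass between forests and
    trees and to rule out infinite distances.\<close>
  moreover have B1_acyclic: "\<nexists>c. cycle V E c" if B1
    using that cycle_Theta unfolding B1 by (metis Id_on_iff)
  moreover have acyclic_B4: B4 if "\<nexists>c. cycle V E c"
    unfolding B4_def
  proof (intro ballI impI)
    fix e f assume "e \<in> E" "f \<in> E" "e \<noteq> f"
    then show "card (Delta V E e f) \<noteq> 2"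
      using acyclic_card_Delta[OF that] card_Delta_infinite
      by (cases "\<exists>u\<in>e. \<exists>v\<in>f. gdist V E u v \<noteq> \<infinity>") auto
  qed
  moreover have B4_B1: B1 if B4
  proof -
    have "e = f" if "(e, f) \<in> Theta V E" for e f
      using that \<open>B4\<close> card_Delta_of_Theta Theta_subset unfolding B4_def by blast
    then show ?thesis unfolding B1 using rel by (auto dest: refl_onD)
  qed
  moreover have "B3 \<longleftrightarrow> B4" if "connected_graph V E"
    using that B1_acyclic acyclic_B4 B4_B1 unfolding B3_def tree_def by blast
  moreover have "B4 \<longleftrightarrow> B4'" if conn: "connected_graph V E"
  proof
    assume B4'
    then show B4 unfolding B4_def B4'_def by simp
  next
    assume B4
    then have acyclic: "\<nexists>c. cycle V E c" using B1_acyclic B4_B1 by blast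
    show B4' unfolding B4'_def
    proof (intro ballI impI)
      fix e f assume ef: "e \<in> E" "f \<in> E" "e \<noteq> f"
      obtain a b where ab: "e = {a, b}" "a \<in> V" using ef(1) by (metis edgeE)
      obtain x y where xy: "f = {x, y}" "x \<in> V" using ef(2) by (metis edgeE)
      obtain p where "path V E a p x" using conn ab xy unfolding connected_graph_def by blast
      then have "gdist V E a x \<noteq> \<infinity>" using gdist_le[of a p x] by (cases "gdist V E a x") auto
      then show "card (Delta V E e f) = 3" using acyclic_card_Delta[OF acyclic ef] ab xy by blast
    qed
  qed
  ultimately show ?thesis using A1 A2 by blast
qed

end
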